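(* Suppose that $S^{\max}-S^{\min}<2\Delta<S^{\min}$. Then there exists a unique interior equilibrium $h$. Its expected add-on level in each state is given by the functional equation $$\bar q(\theta)=\frac12\Big[S(\theta)-\Delta+\min_{M\in\mathcal{M}}\sum_{\theta'\in\Theta}\mu(\theta'\mid\theta'_M=\theta_M)\,\bar q(\theta')\Big]\qquad(\theta\in\Theta),$$ that is, $\bar q$ is the unique solution of this equation. In particular, $S^{\min}-\Delta\le\bar q(\theta)\le S^{\max}-\Delta$ for every $\theta\in\Theta$.
   Context: Primitives: $\Theta=\Theta_1\times\cdots\times\Theta_n$ is a finite set of states; $\mu$ is a full-support probability distribution on $\Theta$; $S:\Theta\to(0,\infty)$ is one-to-one; $S^{\max}=\max_\theta S(\theta)$, $S^{\min}=\min_\theta S(\theta)$; $v^*,c$ are real numbers with $\Delta=v^*-c>0$; $\mathcal{M}$ is a finite nonempty collection of subsets of $\{1,\dots,n\}$ (consumers' cognitive types). For $M\subseteq\{1,\dots,n\}$ write $\theta_M=(\theta_i)_{i\in M}$, and let $\mu(\theta'\mid\theta'_M=\theta_M)$ be $\mu(\theta')/\sum_{\theta'':\theta''_M=\theta_M}\mu(\theta'')$ if $\theta'_M=\theta_M$, and $0$ otherwise. Firms have types $\pi\sim U[0,1]$; a type-$\pi$ firm is active at state $\theta$ and price $\phi$ iff $\phi-c+\pi S(\theta)\ge0$, and its add-on is $\pi S(\theta)$. Let $\pi^\star(\theta,\phi)=(c-\phi)/S(\theta)$ be the marginal type. For a price function $h:\Theta\to\mathbb{R}$, the expected add-on among active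 firms in state $\theta$ is $\bar q(\theta)=\frac{1+\pi^\star(\theta,h(\theta))}{2}S(\theta)$. Equilibrium (homogeneous-preference limit, in which all consumers' bare valuation is $v^*$ and equilibrium prices are taken to be fully revealing): $h:\Theta\to\mathbb{R}$ is an interior equilibrium if for every $\theta$, $\pi^\star(\theta,h(\theta))\in(0,1)$ and $$h(\theta)=v^*-\min_{M\in\mathcal{M}}\sum_{\theta'}\mu(\theta'\mid\theta'_M=\theta_M)\,\bar q(\theta').$$ *)

theory Defs
  imports "HOL-Probability.Probability"
begin

text \<open>A state is a function on the coordinates \<open>{1..n}\<close>, and the set of states
  \<open>\<Theta>\<close> is always an extensional product, so equality of the restrictions to \<open>M\<close>
  says that the two states have the same coordinates in \<open>M\<close>.\<close>

type_synonym 'a state = "nat \<Rightarrow> 'a"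

definition belief ::
  "'a state set \<Rightarrow> 'a state pmf \<Rightarrow> nat set \<Rightarrow> 'a state \<Rightarrow> 'a state \<Rightarrow> real" where
  "belief \<Theta> \<mu> M \<theta> \<theta>' =
     (if restrict \<theta>' M = restrict \<theta> M
      then pmf \<mu> \<theta>' / (\<Sum>\<theta>''\<in>{\<theta>''\<in>\<Theta>. restrict \<theta>'' M = restrict \<theta> M}. pmf \<mu> \<theta>'')
      else 0)"

definition min_expectation ::
  "'a state set \<Rightarrow> 'a state pmf \<Rightarrow> nat set set \<Rightarrow> ('a state \<Rightarrow> real) \<Rightarrow> 'a state \<Rightarrow> real" where
  "min_expectation \<Theta> \<mu> \<M> q \<theta> = (MIN M\<in>\<M>. \<Sum>\<theta>'\<in>\<Theta>. belief \<Theta> \<mu> M \<theta> \<theta>' * q \<theta>')"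

definition active :: "('a state \<Rightarrow> real) \<Rightarrow> real \<Rightarrow> 'a state \<Rightarrow> real \<Rightarrow> real \<Rightarrow> bool" where
  "active S c \<theta> \<phi> \<pi> \<longleftrightarrow> \<phi> - c + \<pi> * S \<theta> \<ge> 0"

definition marginal_type :: "('a state \<Rightarrow> real) \<Rightarrow> real \<Rightarrow> 'a state \<Rightarrow> real \<Rightarrow> real" where
  "marginal_type S c \<theta> \<phi> = (c - \<phi>) / S \<theta>"

definition expected_addon ::
  "('a state \<Rightarrow> real) \<Rightarrow> real \<Rightarrow> ('a state \<Rightarrow> real) \<Rightarrow> 'a state \<Rightarrow> real" where
  "expected_addon S c h \<theta> = (1 + marginal_type S c \<theta> (h \<theta>)) / 2 * S \<theta>"

text \<open>The closed form above is the conditional expectation of the add-on \<open>\<pi> * S \<theta>\<close>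
  given that the firm is active, for \<open>\<pi>\<close> uniform on \<open>[0,1]\<close>, whenever the marginal
  type is interior.\<close>

lemma expected_addon_eq_conditional_expectation:
  fixes S h :: "'a state \<Rightarrow> real" and c :: real and \<theta> :: "'a state"
  defines "U \<equiv> uniform_measure lborel {0..1::real}"
    and "A \<equiv> {\<pi>. active S c \<theta> (h \<theta>) \<pi>}"
  assumes S: "S \<theta> > 0"
    and interior: "marginal_type S c \<theta> (h \<theta>) \<in> {0<..<1}"
  shows "expected_addon S c h \<theta> = (LINT \<pi>:A|U. \<pi> * S \<theta>) / measure U A"
proof -
  define p where "p = marginal_type S c \<theta> (h \<theta>)"
  have p: "0 < p" "p < 1" using interior by (auto simp: p_def)
  have A: "A = {p..}"
    using S by (auto simp: A_def active_def p_def marginal_type_def field_simps)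
  have U: "U = density lborel (\<lambda>x. ennreal (indicator {0..1} x))"
    by (simp add: U_def uniform_measure_def ennreal_indicator divide_ennreal_def)
  have int: "{0..1} \<inter> {p..} = {p..1}" using p by auto
  have mA: "measure U A = 1 - p"
    using p by (simp add: A U_def int measure_def divide_ennreal_def)
  have "(LINT \<pi>:A|U. \<pi> * S \<theta>) = (LINT \<pi>|lborel. (\<pi> * S \<theta>) * indicator {p..1} \<pi>)"
    using p unfolding U set_lebesgue_integral_def A
    by (subst integral_density)
      (auto intro!: Bochner_Integration.integral_cong simp: indicator_def split: if_splits)
  also have "\<dots> = S \<theta> * 1\<^sup>2 / 2 - S \<theta> * p\<^sup>2 / 2"
    using p by (intro integral_FTC_Icc_real)
      (auto intro!: derivative_eq_intros continuous_intros)
  finally have I: "(LINT \<pi>:A|U. \<pi> * S \<theta>) = (1 + p) / 2 * S \<theta> * (1 - p)"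
    by (simp add: algebra_simps power2_eq_square)
  show ?thesis
    unfolding I mA expected_addon_def p_def[symmetric] using p by (simp add: field_simps)
qed

definition interior_equilibrium ::
  "'a state set \<Rightarrow> 'a state pmf \<Rightarrow> ('a state \<Rightarrow> real) \<Rightarrow> real \<Rightarrow> real \<Rightarrow> nat set set
    \<Rightarrow> ('a state \<Rightarrow> real) \<Rightarrow> bool" where
  "interior_equilibrium \<Theta> \<mu> S v c \<M> h \<longleftrightarrow>
     (\<forall>\<theta>\<in>\<Theta>. marginal_type S c \<theta> (h \<theta>) \<in> {0<..<1} \<and>
            h \<theta> = v - min_expectation \<Theta> \<mu> \<M> (expected_addon S c h) \<theta>)"

definition addon_equation ::
  "'a state set \<Rightarrow> 'a state pmf \<Rightarrow> ('a state \<Rightarrow> real) \<Rightarrow> real \<Rightarrow> nat set set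
    \<Rightarrow> ('a state \<Rightarrow> real) \<Rightarrow> bool" where
  "addon_equation \<Theta> \<mu> S \<Delta> \<M> q \<longleftrightarrow>
     (\<forall>\<theta>\<in>\<Theta>. q \<theta> = 1 / 2 * (S \<theta> - \<Delta> + min_expectation \<Theta> \<mu> \<M> q \<theta>))"

end

theory Submission
  imports Defs
begin

text \<open>The minimal conditional expectation is monotone and commutes with adding constants, so the
  right-hand side of the add-on equation is monotone and contracts by the factor \<open>1/2\<close>.
  Hence every subsolution lies below every supersolution. This gives uniqueness, and the bounds by
  comparison with the constants \<open>S_min - \<Delta>\<close> and \<open>S_max - \<Delta>\<close>; the supremum of all
  subsolutions is a solution. Finally, \<open>expected_addon S c h = (S + c - h) / 2\<close> turns the
  equilibrium condition into the add-on equation, and the bounds are what makes the marginal type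
  interior.\<close>

text \<open>The division by \<open>S \<theta>\<close> inside the marginal type cancels, so the
  add-on is affine in the price with slope -1/2. Prices and add-ons therefore determine each other
  state by state.\<close>

lemma expected_addon_eq:
  assumes "S \<theta> > 0"
  shows "expected_addon S c h \<theta> = (S \<theta> + c - h \<theta>) / 2"
  using assms by (simp add: expected_addon_def marginal_type_def field_simps)

locale cognitive_types =
  fixes \<Theta> :: "'a state set" and \<mu> :: "'a state pmf" and \<M> :: "nat set set"
  assumes finite_states: "finite \<Theta>"
    and full_support: "set_pmf \<mu> = \<Theta>"
    and finite_types: "finite \<M>"
    and types_nonempty: "\<M> \<noteq> {}"
begin

section \<open>Conditional beliefs and the minimal expectation\<close>

lemma belief_nonneg: "belief \<Theta> \<mu> M \<theta> \<theta>' \<ge> 0"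
  by (simp add: belief_def sum_nonneg)

text \<open>The conditioning cell contains \<open>\<theta>\<close> itself, so full support makes the
  normalising sum positive.\<close>

lemma sum_belief:
  assumes "\<theta> \<in> \<Theta>"
  shows "(\<Sum>\<theta>'\<in>\<Theta>. belief \<Theta> \<mu> M \<theta> \<theta>') = 1"
proof -
  define C where "C = {\<theta>'\<in>\<Theta>. restrict \<theta>' M = restrict \<theta> M}"
  have C: "finite C" "\<theta> \<in> C"
    using finite_states assms by (auto simp: C_def)
  have "pmf \<mu> \<theta> > 0"
    using assms full_support by (simp add: pmf_positive)
  also have "pmf \<mu> \<theta> \<le> (\<Sum>\<theta>'\<in>C. pmf \<mu> \<theta>')"
    using C by (intro member_le_sum) auto
  finally have pos: "(\<Sum>\<theta>'\<in>C. pmf \<mu> \<theta>') > 0" .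
  have "(\<Sum>\<theta>'\<in>\<Theta>. belief \<Theta> \<mu> M \<theta> \<theta>') = (\<Sum>\<theta>'\<in>C. pmf \<mu> \<theta>' / (\<Sum>\<theta>''\<in>C. pmf \<mu> \<theta>''))"
    unfolding belief_def C_def
    using finite_states by (intro sum.mono_neutral_cong_right) auto
  also have "\<dots> = 1"
    using pos by (simp flip: sum_divide_distrib)
  finally show ?thesis .
qed

text \<open>Evaluate \<open>p\<close> under the type \<open>M\<close> that is optimal for
  \<open>q\<close>: this bounds the minimum for \<open>p\<close> from above, and since the weights
  sum to 1 the constant \<open>d\<close> comes out of the sum. The case \<open>d = 0\<close> is
  monotonicity; general \<open>d\<close> yields the contraction estimate.\<close>

lemma min_expectation_le_add:
  assumes "\<theta> \<in> \<Theta>" and le: "\<And>\<theta>'. \<theta>' \<in> \<Theta> \<Longrightarrow> p \<theta>' \<le> q \<theta>' + d"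
  shows "min_expectation \<Theta> \<mu> \<M> p \<theta> \<le> min_expectation \<Theta> \<mu> \<M> q \<theta> + d"
proof -
  let ?E = "\<lambda>q M. \<Sum>\<theta>'\<in>\<Theta>. belief \<Theta> \<mu> M \<theta> \<theta>' * q \<theta>'"
  have "min_expectation \<Theta> \<mu> \<M> q \<theta> \<in> ?E q ` \<M>"
    unfolding min_expectation_def using finite_types types_nonempty by (intro Min_in) auto
  then obtain M where M: "M \<in> \<M>" "min_expectation \<Theta> \<mu> \<M> q \<theta> = ?E q M"
    by blast
  have "min_expectation \<Theta> \<mu> \<M> p \<theta> \<le> ?E p M"
    unfolding min_expectation_def using finite_types M by (intro Min_le) auto
  also have "\<dots> \<le> (\<Sum>\<theta>'\<in>\<Theta>. belief \<Theta> \<mu> M \<theta> \<theta>' * (q \<theta>' + d))"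
    using le belief_nonneg by (intro sum_mono mult_left_mono) auto
  also have "\<dots> = ?E q M + d"
    using sum_belief[OF assms(1), of M]
    by (simp add: distrib_left sum.distrib flip: sum_distrib_right)
  finally show ?thesis
    using M by simp
qed

lemma min_expectation_mono:
  assumes "\<theta> \<in> \<Theta>" and "\<And>\<theta>'. \<theta>' \<in> \<Theta> \<Longrightarrow> p \<theta>' \<le> q \<theta>'"
  shows "min_expectation \<Theta> \<mu> \<M> p \<theta> \<le> min_expectation \<Theta> \<mu> \<M> q \<theta>"
  using min_expectation_le_add[of \<theta> p q 0] assms by simp

lemma min_expectation_cong:
  assumes "\<theta> \<in> \<Theta>" and "\<And>\<theta>'. \<theta>' \<in> \<Theta> \<Longrightarrow> p \<theta>' = q \<theta>'"
  shows "min_expectation \<Theta> \<mu> \<M> p \<theta> = min_expectation \<Theta> \<mu> \<M> q \<theta>"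
  using assms by (intro antisym min_expectation_mono) simp_all

lemma min_expectation_const:
  assumes "\<theta> \<in> \<Theta>"
  shows "min_expectation \<Theta> \<mu> \<M> (\<lambda>_. k) \<theta> = k"
  using sum_belief[OF assms] types_nonempty
  by (simp add: min_expectation_def image_constant_conv flip: sum_distrib_right)

section \<open>The add-on map, its subsolutions and supersolutions\<close>

definition addon_map :: "('a state \<Rightarrow> real) \<Rightarrow> real \<Rightarrow> ('a state \<Rightarrow> real) \<Rightarrow> 'a state \<Rightarrow> real" where
  "addon_map S \<Delta> q \<theta> = 1 / 2 * (S \<theta> - \<Delta> + min_expectation \<Theta> \<mu> \<M> q \<theta>)"

lemma addon_equation_iff:
  "addon_equation \<Theta> \<mu> S \<Delta> \<M> q \<longleftrightarrow> (\<forall>\<theta>\<in>\<Theta>. q \<theta> = addon_map S \<Delta> q \<theta>)"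
  by (simp add: addon_equation_def addon_map_def)

lemma addon_equation_subsolution:
  assumes "addon_equation \<Theta> \<mu> S \<Delta> \<M> q" and "\<theta> \<in> \<Theta>"
  shows "q \<theta> \<le> addon_map S \<Delta> q \<theta>"
  using assms unfolding addon_equation_iff by (metis order_refl)

lemma addon_equation_supersolution:
  assumes "addon_equation \<Theta> \<mu> S \<Delta> \<M> q" and "\<theta> \<in> \<Theta>"
  shows "addon_map S \<Delta> q \<theta> \<le> q \<theta>"
  using assms unfolding addon_equation_iff by (metis order_refl)

lemma addon_map_mono:
  assumes "\<theta> \<in> \<Theta>" and "\<And>\<theta>'. \<theta>' \<in> \<Theta> \<Longrightarrow> p \<theta>' \<le> q \<theta>'"
  shows "addon_map S \<Delta> p \<theta> \<le> addon_map S \<Delta> q \<theta>"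
  using min_expectation_mono[OF assms] by (simp add: addon_map_def)

lemma addon_map_const:
  assumes "\<theta> \<in> \<Theta>"
  shows "addon_map S \<Delta> (\<lambda>_. k) \<theta> = (S \<theta> - \<Delta> + k) / 2"
  using assms by (simp add: addon_map_def min_expectation_const)

text \<open>A maximum principle: where \<open>p - q\<close> attains its maximum \<open>d\<close>,
  the factor 1/2 in the map forces \<open>d \<le> d / 2\<close>, so \<open>d\<close> cannot be
  positive.\<close>

lemma subsolution_le_supersolution:
  assumes sub: "\<And>\<theta>. \<theta> \<in> \<Theta> \<Longrightarrow> p \<theta> \<le> addon_map S \<Delta> p \<theta>"
    and super: "\<And>\<theta>. \<theta> \<in> \<Theta> \<Longrightarrow> addon_map S \<Delta> q \<theta> \<le> q \<theta>"
    and "\<theta> \<in> \<Theta>"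
  shows "p \<theta> \<le> q \<theta>"
proof -
  define d where "d = (MAX \<theta>\<in>\<Theta>. p \<theta> - q \<theta>)"
  have gap: "p \<theta>' - q \<theta>' \<le> d" if "\<theta>' \<in> \<Theta>" for \<theta>'
    unfolding d_def using finite_states that by (intro Max_ge) auto
  have "d \<in> (\<lambda>\<theta>. p \<theta> - q \<theta>) ` \<Theta>"
    unfolding d_def using finite_states \<open>\<theta> \<in> \<Theta>\<close> by (intro Max_in) auto
  then obtain \<theta>' where \<theta>': "\<theta>' \<in> \<Theta>" "d = p \<theta>' - q \<theta>'"
    by blast
  have "min_expectation \<Theta> \<mu> \<M> p \<theta>' \<le> min_expectation \<Theta> \<mu> \<M> q \<theta>' + d"
    using \<theta>'(1) by (rule min_expectation_le_add) (use gap in force)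
  then have "d \<le> d / 2"
    using sub[OF \<theta>'(1)] super[OF \<theta>'(1)] \<theta>'(2) by (simp add: addon_map_def)
  then show ?thesis
    using gap[OF \<open>\<theta> \<in> \<Theta>\<close>] by simp
qed

lemma addon_equation_unique:
  assumes "addon_equation \<Theta> \<mu> S \<Delta> \<M> p" and "addon_equation \<Theta> \<mu> S \<Delta> \<M> q" and "\<theta> \<in> \<Theta>"
  shows "p \<theta> = q \<theta>"
proof (rule antisym)
  show "p \<theta> \<le> q \<theta>"
    using addon_equation_subsolution[OF assms(1)] addon_equation_supersolution[OF assms(2)] assms(3)
    by (rule subsolution_le_supersolution)
  show "q \<theta> \<le> p \<theta>"
    using addon_equation_subsolution[OF assms(2)] addon_equation_supersolution[OF assms(1)] assms(3)
    by (rule subsolution_le_supersolution)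
qed

text \<open>The map sends the constant \<open>k\<close> to
  \<open>(S \<theta> - \<Delta> + k) / 2\<close>, which is at least \<open>k\<close> exactly when
  \<open>k \<le> S \<theta> - \<Delta>\<close>. So \<open>a - \<Delta>\<close> is a subsolution and
  \<open>b - \<Delta>\<close> a supersolution.\<close>

lemma addon_equation_bounds:
  assumes "addon_equation \<Theta> \<mu> S \<Delta> \<M> q"
    and "\<And>\<theta>. \<theta> \<in> \<Theta> \<Longrightarrow> a \<le> S \<theta>" and "\<And>\<theta>. \<theta> \<in> \<Theta> \<Longrightarrow> S \<theta> \<le> b" and "\<theta> \<in> \<Theta>"
  shows "a - \<Delta> \<le> q \<theta>" and "q \<theta> \<le> b - \<Delta>"
proof -
  show "a - \<Delta> \<le> q \<theta>"
    by (rule subsolution_le_supersolution[where p = "\<lambda>_. a - \<Delta>" and S = S and \<Delta> = \<Delta>])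
      (use assms(2,4) addon_equation_supersolution[OF assms(1)] in \<open>auto simp: addon_map_const field_simps\<close>)
  show "q \<theta> \<le> b - \<Delta>"
    by (rule subsolution_le_supersolution[where q = "\<lambda>_. b - \<Delta>" and S = S and \<Delta> = \<Delta>])
      (use assms(3,4) addon_equation_subsolution[OF assms(1)] in \<open>auto simp: addon_map_const field_simps\<close>)
qed

text \<open>The argument of the Knaster-Tarski theorem, with comparison against constants supplying
  the bounds that a complete lattice would give.\<close>

lemma addon_equation_exists: "\<exists>q. addon_equation \<Theta> \<mu> S \<Delta> \<M> q"
proof -
  define a where "a = Min (S ` \<Theta>)"
  define b where "b = Max (S ` \<Theta>)"
  define P where "P = {p. \<forall>\<theta>\<in>\<Theta>. p \<theta> \<le> addon_map S \<Delta> p \<theta>}"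
  define q where "q \<theta> = (SUP p\<in>P. p \<theta>)" for \<theta>
  have a: "a \<le> S \<theta>" and b: "S \<theta> \<le> b" if "\<theta> \<in> \<Theta>" for \<theta>
    using that finite_states by (auto simp: a_def b_def)
  have P_nonempty: "P \<noteq> {}"
  proof -
    have "(\<lambda>_. a - \<Delta>) \<in> P"
      using a by (force simp: P_def addon_map_const)
    then show ?thesis by blast
  qed
  \<comment> \<open>The constant \<open>b - \<Delta>\<close> is a supersolution and so bounds every
    subsolution; without such a bound the real supremum defining \<open>q\<close> would carry no
    information.\<close>
  have "p \<theta> \<le> b - \<Delta>" if "p \<in> P" "\<theta> \<in> \<Theta>" for p \<theta>
    by (rule subsolution_le_supersolution[where q = "\<lambda>_. b - \<Delta>" and S = S and \<Delta> = \<Delta>])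
      (use that b in \<open>auto simp: P_def addon_map_const field_simps\<close>)
  then have bdd: "bdd_above ((\<lambda>p. p \<theta>) ` P)" if "\<theta> \<in> \<Theta>" for \<theta>
    using that by (auto intro!: bdd_aboveI)
  have upper: "p \<theta> \<le> q \<theta>" if "p \<in> P" "\<theta> \<in> \<Theta>" for p \<theta>
    unfolding q_def using that bdd by (intro cSUP_upper) auto
  have sub: "q \<theta> \<le> addon_map S \<Delta> q \<theta>" if "\<theta> \<in> \<Theta>" for \<theta>
    unfolding q_def[of \<theta>]
  proof (rule cSUP_least[OF P_nonempty])
    fix p assume "p \<in> P"
    then have "p \<theta> \<le> addon_map S \<Delta> p \<theta>"
      using that by (simp add: P_def)
    also have "\<dots> \<le> addon_map S \<Delta> q \<theta>"
      using that upper \<open>p \<in> P\<close> by (intro addon_map_mono)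
    finally show "p \<theta> \<le> addon_map S \<Delta> q \<theta>" .
  qed
  \<comment> \<open>Applying the monotone map to both sides of \<open>sub\<close> shows that the
    image of \<open>q\<close> is again a subsolution. It thus lies below the supremum
    \<open>q\<close>, which is the converse inequality.\<close>
  have "addon_map S \<Delta> q \<in> P"
    using sub by (auto simp: P_def intro!: addon_map_mono)
  then show ?thesis
    using upper sub by (intro exI[of _ q]) (force simp: addon_equation_iff intro: antisym)
qed

section \<open>Equilibria and solutions of the add-on equation\<close>

lemma interior_equilibrium_imp_addon_equation:
  assumes "interior_equilibrium \<Theta> \<mu> S v c \<M> h" and "\<And>\<theta>. \<theta> \<in> \<Theta> \<Longrightarrow> S \<theta> > 0"
  shows "addon_equation \<Theta> \<mu> S (v - c) \<M> (expected_addon S c h)"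
  unfolding addon_equation_def
proof
  fix \<theta> assume \<theta>: "\<theta> \<in> \<Theta>"
  have "h \<theta> = v - min_expectation \<Theta> \<mu> \<M> (expected_addon S c h) \<theta>"
    using assms(1) \<theta> by (simp add: interior_equilibrium_def)
  then show "expected_addon S c h \<theta> =
      1 / 2 * (S \<theta> - (v - c) + min_expectation \<Theta> \<mu> \<M> (expected_addon S c h) \<theta>)"
    using expected_addon_eq[of S \<theta> c h] assms(2)[OF \<theta>] by simp
qed

text \<open>Write \<Delta> for \<open>v - c\<close> and E for the minimal expectation of
  \<open>q\<close>. The marginal type is (E - \<Delta>) / \<open>S \<theta>\<close>, and E lies
  between \<open>a\<close> - \<Delta> and \<open>b\<close> - \<Delta>. The numerator is at least
  \<open>a\<close> - 2\<Delta> > 0 and at most \<open>b\<close> - 2\<Delta> < \<open>a\<close> \<le>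
  \<open>S \<theta>\<close>.\<close>

lemma addon_equation_imp_interior_equilibrium:
  assumes q: "addon_equation \<Theta> \<mu> S (v - c) \<M> q"
    and pos: "\<And>\<theta>. \<theta> \<in> \<Theta> \<Longrightarrow> S \<theta> > 0"
    and h: "\<And>\<theta>. \<theta> \<in> \<Theta> \<Longrightarrow> h \<theta> = v - min_expectation \<Theta> \<mu> \<M> q \<theta>"
    and a: "\<And>\<theta>. \<theta> \<in> \<Theta> \<Longrightarrow> a \<le> S \<theta>" and b: "\<And>\<theta>. \<theta> \<in> \<Theta> \<Longrightarrow> S \<theta> \<le> b"
    and ab: "b - a < 2 * (v - c)" "2 * (v - c) < a"
  shows "interior_equilibrium \<Theta> \<mu> S v c \<M> h"
  unfolding interior_equilibrium_def
proof (intro ballI conjI)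
  fix \<theta> assume \<theta>: "\<theta> \<in> \<Theta>"
  have "a - (v - c) \<le> min_expectation \<Theta> \<mu> \<M> q \<theta>"
    using min_expectation_mono[OF \<theta>, of "\<lambda>_. a - (v - c)" q]
      addon_equation_bounds(1)[OF q a b] \<theta> by (simp add: min_expectation_const)
  moreover have "min_expectation \<Theta> \<mu> \<M> q \<theta> \<le> b - (v - c)"
    using min_expectation_mono[OF \<theta>, of q "\<lambda>_. b - (v - c)"]
      addon_equation_bounds(2)[OF q a b] \<theta> by (simp add: min_expectation_const)
  ultimately show "marginal_type S c \<theta> (h \<theta>) \<in> {0<..<1}"
    using ab h[OF \<theta>] pos[OF \<theta>] a[OF \<theta>] by (simp add: marginal_type_def)
  \<comment> \<open>The price built from \<open>q\<close> induces \<open>q\<close> as its add-on, so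
    \<open>q\<close> may be replaced by that add-on in the price formula.\<close>
  have "expected_addon S c h \<theta>' = q \<theta>'" if "\<theta>' \<in> \<Theta>" for \<theta>'
    using bspec[OF q[unfolded addon_equation_def] that] expected_addon_eq[of S \<theta>' c h] pos[OF that] h[OF that]
    by simp
  then show "h \<theta> = v - min_expectation \<Theta> \<mu> \<M> (expected_addon S c h) \<theta>"
    using h[OF \<theta>] min_expectation_cong[OF \<theta>, of "expected_addon S c h" q] by simp
qed

end

theorem proposition2:
  fixes n :: nat
    and \<Theta>c :: "nat \<Rightarrow> 'a set"
    and \<Theta> :: "'a state set"
    and \<mu> :: "'a state pmf"
    and S :: "'a state \<Rightarrow> real"
    and S_max S_min v c \<Delta> :: real
    and \<M> :: "nat set set"
  assumes "\<Theta> = (\<Pi>\<^sub>E i\<in>{1..n}. \<Theta>c i)"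
    and "finite \<Theta>"
    and "set_pmf \<mu> = \<Theta>"
    and "\<forall>\<theta>\<in>\<Theta>. S \<theta> > 0"
    and "inj_on S \<Theta>"
    and "S_max = (MAX \<theta>\<in>\<Theta>. S \<theta>)"
    and "S_min = (MIN \<theta>\<in>\<Theta>. S \<theta>)"
    and "\<Delta> = v - c"
    and "\<Delta> > 0"
    and "finite \<M>"
    and "\<M> \<noteq> {}"
    and "\<forall>M\<in>\<M>. M \<subseteq> {1..n}"
    and "S_max - S_min < 2 * \<Delta>"
    and "2 * \<Delta> < S_min"
  shows "(\<exists>!h. h \<in> \<Theta> \<rightarrow>\<^sub>E UNIV \<and> interior_equilibrium \<Theta> \<mu> S v c \<M> h) \<and>
    (\<forall>h. interior_equilibrium \<Theta> \<mu> S v c \<M> h \<longrightarrow>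
       addon_equation \<Theta> \<mu> S \<Delta> \<M> (expected_addon S c h) \<and>
       (\<forall>q. addon_equation \<Theta> \<mu> S \<Delta> \<M> q \<longrightarrow> (\<forall>\<theta>\<in>\<Theta>. q \<theta> = expected_addon S c h \<theta>)) \<and>
       (\<forall>\<theta>\<in>\<Theta>. S_min - \<Delta> \<le> expected_addon S c h \<theta> \<and>
              expected_addon S c h \<theta> \<le> S_max - \<Delta>))"
proof -
  interpret cognitive_types \<Theta> \<mu> \<M>
    using assms by unfold_locales
  have pos: "S \<theta> > 0" and lower: "S_min \<le> S \<theta>" and upper: "S \<theta> \<le> S_max" if "\<theta> \<in> \<Theta>" for \<theta>
    using assms that by auto
  have sol: "addon_equation \<Theta> \<mu> S \<Delta> \<M> (expected_addon S c h)"
    if "interior_equilibrium \<Theta> \<mu> S v c \<M> h" for h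
    using interior_equilibrium_imp_addon_equation[OF that pos] assms by simp
  have "\<exists>!h. h \<in> \<Theta> \<rightarrow>\<^sub>E UNIV \<and> interior_equilibrium \<Theta> \<mu> S v c \<M> h"
  proof (rule ex_ex1I)
    obtain q where q: "addon_equation \<Theta> \<mu> S (v - c) \<M> q"
      using addon_equation_exists by blast
    \<comment> \<open>Equilibrium constrains prices only on \<open>\<Theta>\<close>; the restriction
      fixes the values elsewhere, so that uniqueness can hold as equality of functions.\<close>
    define h where "h = restrict (\<lambda>\<theta>. v - min_expectation \<Theta> \<mu> \<M> q \<theta>) \<Theta>"
    have "interior_equilibrium \<Theta> \<mu> S v c \<M> h"
      by (rule addon_equation_imp_interior_equilibrium[OF q pos _ lower upper])
        (use assms in \<open>simp_all add: h_def\<close>)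
    moreover have "h \<in> \<Theta> \<rightarrow>\<^sub>E UNIV"
      by (simp add: h_def)
    ultimately show "\<exists>h. h \<in> \<Theta> \<rightarrow>\<^sub>E UNIV \<and> interior_equilibrium \<Theta> \<mu> S v c \<M> h"
      by blast
  next
    fix h h' assume h: "h \<in> \<Theta> \<rightarrow>\<^sub>E UNIV \<and> interior_equilibrium \<Theta> \<mu> S v c \<M> h"
      and h': "h' \<in> \<Theta> \<rightarrow>\<^sub>E UNIV \<and> interior_equilibrium \<Theta> \<mu> S v c \<M> h'"
    \<comment> \<open>Both equilibria have the same add-on, and the affine relation recovers the
      price as \<open>S \<theta> + c\<close> minus twice the add-on.\<close>
    have "h \<theta> = h' \<theta>" if "\<theta> \<in> \<Theta>" for \<theta>
      using addon_equation_unique[OF sol[of h] sol[of h'] that] h h'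
        expected_addon_eq[of S \<theta>] pos[OF that]
      by simp
    then show "h = h'"
      using h h' by (auto intro: PiE_ext)
  qed
  moreover have "q \<theta> = expected_addon S c h \<theta>"
    if "interior_equilibrium \<Theta> \<mu> S v c \<M> h" "addon_equation \<Theta> \<mu> S \<Delta> \<M> q" "\<theta> \<in> \<Theta>" for h q \<theta>
    using addon_equation_unique[OF that(2) sol[OF that(1)] that(3)] .
  moreover have "S_min - \<Delta> \<le> expected_addon S c h \<theta>" "expected_addon S c h \<theta> \<le> S_max - \<Delta>"
    if "interior_equilibrium \<Theta> \<mu> S v c \<M> h" "\<theta> \<in> \<Theta>" for h \<theta>
    using addon_equation_bounds[OF sol[OF that(1)] lower upper that(2)] by simp_all
  ultimately show ?thesis
    using sol by (intro conjI allI impI ballI)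
qed

end
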